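(* (Strong law of large numbers.) Let $\{X_t\}_{t\ge 0}$ be a semi-Lévy process on $\mathbb{R}^d$ with period $p>0$. (i) If $E[|X_p|]<\infty$, then $\lim_{t\to\infty}t^{-1}X_t=p^{-1}E[X_p]$ almost surely. (ii) If $E[|X_p|]=\infty$, then $\limsup_{t\to\infty}t^{-1}|X_t|=\infty$ almost surely.
   Context: An additive process on $\mathbb{R}^d$ is an $\mathbb{R}^d$-valued stochastic process $\{X_t\}_{t\ge 0}$ with $X_0=0$ a.s. that is stochastically continuous, has independent increments, and has sample paths that are right-continuous in $t\ge 0$ with left limits in $t>0$. A semi-Lévy process with period $p>0$ is an additive process such that $X_{t+p}-X_{s+p}$ and $X_t-X_s$ have the same distribution for all $s,t\ge 0$. $|x|$ denotes the Euclidean norm. *)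

theory Defs
  imports "HOL-Probability.Probability"
begin

text \<open>Processes are indexed by the type \<^typ>\<open>real\<close>, but only their values at times \<open>t \<ge> 0\<close>
  are constrained. The path regularity is required of every sample path.\<close>

definition stochastically_continuous ::
    "'w measure \<Rightarrow> (real \<Rightarrow> 'w \<Rightarrow> 'a::euclidean_space) \<Rightarrow> bool" where
  "stochastically_continuous M X \<longleftrightarrow>
     (\<forall>t\<ge>0. \<forall>\<epsilon>>0.
        ((\<lambda>s. measure M {\<omega> \<in> space M. norm (X s \<omega> - X t \<omega>) > \<epsilon>}) \<longlongrightarrow> 0)
          (at t within {0..}))"

definition (in prob_space) independent_increments ::
    "(real \<Rightarrow> 'a \<Rightarrow> 'b::euclidean_space) \<Rightarrow> bool" where
  "independent_increments X \<longleftrightarrow>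
     (\<forall>(n::nat) (\<tau>::nat \<Rightarrow> real).
        0 \<le> \<tau> 0 \<and> (\<forall>i<n. \<tau> i < \<tau> (Suc i)) \<longrightarrow>
          indep_vars (\<lambda>_. borel) (\<lambda>i \<omega>. X (\<tau> (Suc i)) \<omega> - X (\<tau> i) \<omega>) {..<n})"

definition cadlag :: "(real \<Rightarrow> 'a::euclidean_space) \<Rightarrow> bool" where
  "cadlag x \<longleftrightarrow>
     (\<forall>t\<ge>0. continuous (at_right t) x) \<and> (\<forall>t>0. \<exists>l. (x \<longlongrightarrow> l) (at_left t))"

locale additive_process = prob_space M
  for M :: "'w measure" and X :: "real \<Rightarrow> 'w \<Rightarrow> 'a::euclidean_space" +
  assumes measurable_process: "\<And>t. t \<ge> 0 \<Longrightarrow> X t \<in> borel_measurable M"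
    and starts_at_zero: "AE \<omega> in M. X 0 \<omega> = 0"
    and stochastically_continuous: "stochastically_continuous M X"
    and independent_increments: "independent_increments X"
    and cadlag_paths: "\<And>\<omega>. \<omega> \<in> space M \<Longrightarrow> cadlag (\<lambda>t. X t \<omega>)"

locale semi_levy_process = additive_process M X
  for M :: "'w measure" and X :: "real \<Rightarrow> 'w \<Rightarrow> 'a::euclidean_space" +
  fixes p :: real
  assumes period_pos: "p > 0"
    and periodic_increments: "\<And>s t. s \<ge> 0 \<Longrightarrow> t \<ge> 0 \<Longrightarrow>
      distr M borel (\<lambda>\<omega>. X (t + p) \<omega> - X (s + p) \<omega>) = distr M borel (\<lambda>\<omega>. X t \<omega> - X s \<omega>)"

end

theory Submission
  imports Defs
begin

text \<open>Write \<open>\<xi>\<^sub>n = X((n + 1)p) - X(np)\<close> for the increments over whole periods. They are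
  independent because the increments of \<open>X\<close> are, identically distributed because these are
  \<open>p\<close>-periodic in law, and \<open>\<xi>\<^sub>0 = X(p)\<close> almost surely; so \<open>X\<close> observed at the multiples of \<open>p\<close>
  is a random walk.

  If \<open>X(p)\<close> has finite mean, the classical strong law gives \<open>X(np)/n \<rightarrow> E X(p)\<close>. It is proved here
  coordinate by coordinate: a real random walk with negative drift has partial sums that are almost
  surely bounded above (\<open>negative_drift_sums_bounded_above\<close>, the argument of Garsia's maximal
  ergodic lemma), and applying this to \<open>\<plusminus>(\<xi>\<^sub>n - \<mu>) - \<epsilon>\<close> squeezes the averages.

  It remains to see that the oscillation of \<open>X\<close> during the \<open>n\<close>-th period is \<open>o(n)\<close>. On a finite
  grid, Ottaviani's inequality bounds the probability that the oscillation exceeds \<open>2a\<close> by twice the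
  probability that the full increment \<open>\<xi>\<^sub>n\<close> exceeds \<open>a\<close>, as soon as the increments \<open>X(p) - X(s)\<close>,
  \<open>s \<le> p\<close>, are at most \<open>a\<close> with probability at least one half; stochastic continuity and
  compactness provide one such threshold for all \<open>s\<close>, and by periodicity it serves every
  period. Refining dyadic grids and right-continuity extend the bound to all times of the period.
  Since \<open>\<Sum>\<^sub>n P(|\<xi>\<^sub>n| > cn)\<close> is finite, the Borel--Cantelli lemma finishes the first part.

  If the mean is infinite, the same series diverges for every \<open>c\<close>, and the second Borel--Cantelli
  lemma yields \<open>|\<xi>\<^sub>n| > cn\<close> infinitely often, which is incompatible with \<open>|X(t)| \<le> Ct\<close> for all
  large \<open>t\<close>.\<close>

section \<open>The strong law for independent identically distributed vectors\<close>

text \<open>The maximum of the partial sums of \<open>x\<close> with at most \<open>n\<close> terms, the empty sum included. The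
  recursion peels off the first term, not the last: it relates the maximum for \<open>x\<close> to the maximum for
  the shifted sequence, and the law of an i.i.d. sequence is invariant under this shift.\<close>
primrec max_partial_sum :: "nat \<Rightarrow> (nat \<Rightarrow> real) \<Rightarrow> real" where
  "max_partial_sum 0 x = 0"
| "max_partial_sum (Suc n) x = max 0 (x 0 + max_partial_sum n (\<lambda>i. x (Suc i)))"

lemma max_partial_sum_nonneg: "0 \<le> max_partial_sum n x"
  by (cases n) auto

lemma sum_le_max_partial_sum: "k \<le> n \<Longrightarrow> (\<Sum>i<k. x i) \<le> max_partial_sum n x"
proof (induction n arbitrary: k x)
  case (Suc n)
  show ?case
  proof (cases k)
    case (Suc j)
    with Suc.prems have "(\<Sum>i<j. x (Suc i)) \<le> max_partial_sum n (\<lambda>i. x (Suc i))"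
      by (intro Suc.IH) simp
    then show ?thesis
      using Suc by (simp add: sum.lessThan_Suc_shift del: sum.lessThan_Suc)
  qed simp
qed simp

lemma max_partial_sum_le_Suc: "max_partial_sum n x \<le> max_partial_sum (Suc n) x"
proof (induction n arbitrary: x)
  case (Suc n)
  have "x 0 + max_partial_sum n (\<lambda>i. x (Suc i)) \<le> x 0 + max_partial_sum (Suc n) (\<lambda>i. x (Suc i))"
    using Suc.IH by (intro add_left_mono)
  then show ?case
    unfolding max_partial_sum.simps(2)[of n x] max_partial_sum.simps(2)[of "Suc n" x]
    by (intro max.mono order_refl)
qed simp

lemma max_partial_sum_le_sum_abs: "max_partial_sum n x \<le> (\<Sum>i<n. \<bar>x i\<bar>)"
proof (induction n arbitrary: x)
  case (Suc n)
  have "x 0 + max_partial_sum n (\<lambda>i. x (Suc i)) \<le> \<bar>x 0\<bar> + (\<Sum>i<n. \<bar>x (Suc i)\<bar>)"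
    by (intro add_mono Suc.IH) simp
  moreover have "0 \<le> \<bar>x 0\<bar> + (\<Sum>i<n. \<bar>x (Suc i)\<bar>)"
    by (intro add_nonneg_nonneg sum_nonneg) auto
  ultimately show ?case
    by (simp add: sum.lessThan_Suc_shift del: sum.lessThan_Suc)
qed simp

lemma borel_measurable_max_partial_sum [measurable]:
  "max_partial_sum n \<in> borel_measurable (PiM UNIV (\<lambda>_. borel))"
proof (induction n)
  case (Suc n)
  have "(\<lambda>x i. x (Suc i) :: real) \<in> measurable (PiM UNIV (\<lambda>_. borel)) (PiM UNIV (\<lambda>_. borel))"
    by (intro measurable_abs_UNIV measurable_component_singleton) simp
  then have "(\<lambda>x. max_partial_sum n (\<lambda>i. x (Suc i))) \<in> borel_measurable (PiM UNIV (\<lambda>_. borel))"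
    using Suc by (rule measurable_compose)
  then show ?case
    unfolding max_partial_sum.simps
    by (intro borel_measurable_max borel_measurable_add borel_measurable_const
              measurable_component_singleton) auto
qed simp

definition unbounded_above_sums :: "(nat \<Rightarrow> real) set" where
  "unbounded_above_sums = {x. \<forall>B::nat. \<exists>k. real B < (\<Sum>i<k. x i)}"

text \<open>Dropping the first term changes every partial sum by the same amount. This invariance makes the
  event that the sums are unbounded a function of the terms from index 1 on, hence independent of the
  first term.\<close>
lemma unbounded_above_sums_shift:
  "(\<lambda>i. x (Suc i)) \<in> unbounded_above_sums \<longleftrightarrow> x \<in> unbounded_above_sums"
proof -
  have sums: "(\<Sum>i<Suc k. x i) = x 0 + (\<Sum>i<k. x (Suc i))" for k
    by (simp add: sum.lessThan_Suc_shift del: sum.lessThan_Suc)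
  show ?thesis
  proof
    assume L: "(\<lambda>i. x (Suc i)) \<in> unbounded_above_sums"
    have "\<exists>k. real B < (\<Sum>i<k. x i)" for B :: nat
    proof -
      obtain B' :: nat where B': "real B - x 0 \<le> real B'" using real_arch_simple by blast
      obtain k where "real B' < (\<Sum>i<k. x (Suc i))" using L by (auto simp: unbounded_above_sums_def)
      then have "real B < (\<Sum>i<Suc k. x i)" using B' unfolding sums by linarith
      then show ?thesis by blast
    qed
    then show "x \<in> unbounded_above_sums" by (simp add: unbounded_above_sums_def)
  next
    assume R: "x \<in> unbounded_above_sums"
    have "\<exists>k. real B < (\<Sum>i<k. x (Suc i))" for B :: nat
    proof -
      obtain B' :: nat where B': "real B + \<bar>x 0\<bar> \<le> real B'" using real_arch_simple by blast
      obtain k where k: "real B' < (\<Sum>i<k. x i)" using R by (auto simp: unbounded_above_sums_def)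
      then obtain j where "k = Suc j" using B' by (cases k) auto
      with k have "real B' < x 0 + (\<Sum>i<j. x (Suc i))" using sums[of j] by simp
      then have "real B < (\<Sum>i<j. x (Suc i))" using B' by linarith
      then show ?thesis by blast
    qed
    then show "(\<lambda>i. x (Suc i)) \<in> unbounded_above_sums" by (simp add: unbounded_above_sums_def)
  qed
qed

lemma sets_unbounded_above_sums [measurable]:
  "unbounded_above_sums \<in> sets (PiM UNIV (\<lambda>_. borel))"
proof -
  have [measurable]: "(\<lambda>x. \<Sum>i<k. x i) \<in> borel_measurable (PiM UNIV (\<lambda>_::nat. borel :: real measure))"
    for k :: nat
    by (intro borel_measurable_sum measurable_component_singleton) simp
  have "{x \<in> space (PiM UNIV (\<lambda>_. borel)). \<forall>B::nat. \<exists>k. real B < (\<Sum>i<k. x i)}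
      \<in> sets (PiM UNIV (\<lambda>_::nat. borel :: real measure))"
    by measurable
  then show ?thesis by (simp add: unbounded_above_sums_def space_PiM)
qed

context prob_space
begin

lemma distr_eq_compose:
  fixes f :: "'c::topological_space \<Rightarrow> 'd::topological_space"
  assumes eq: "distr M borel Y = distr M borel Z"
    and [measurable]: "Y \<in> borel_measurable M" "Z \<in> borel_measurable M" "f \<in> borel_measurable borel"
  shows "distr M borel (\<lambda>\<omega>. f (Y \<omega>)) = distr M borel (\<lambda>\<omega>. f (Z \<omega>))"
proof -
  have "distr M borel (\<lambda>\<omega>. f (Y \<omega>)) = distr (distr M borel Y) borel f"
    by (subst distr_distr) (auto simp: comp_def)
  also have "\<dots> = distr M borel (\<lambda>\<omega>. f (Z \<omega>))"
    unfolding eq by (subst distr_distr) (auto simp: comp_def)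
  finally show ?thesis .
qed

lemma distr_eq_integrable:
  fixes Y Z :: "'a \<Rightarrow> 'c::euclidean_space"
  assumes eq: "distr M borel Y = distr M borel Z"
    and [measurable]: "Y \<in> borel_measurable M" "Z \<in> borel_measurable M"
    and int: "integrable M Z"
  shows "integrable M Y"
proof -
  have "integrable (distr M borel Z) (\<lambda>y. y)" using int by (simp add: integrable_distr_eq)
  then show ?thesis unfolding eq[symmetric] by (simp add: integrable_distr_eq)
qed

text \<open>By independence the law of the whole sequence is the product of the marginal laws, and these
  do not change under the shift.\<close>
lemma distr_sequence_shift:
  fixes Y :: "nat \<Rightarrow> 'a \<Rightarrow> real"
  assumes indep: "indep_vars (\<lambda>_. borel) Y UNIV"
    and ident: "\<And>n. distr M borel (Y n) = distr M borel (Y 0)"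
  shows "distr M (PiM UNIV (\<lambda>_. borel)) (\<lambda>\<omega> i. Y (Suc i) \<omega>) =
         distr M (PiM UNIV (\<lambda>_. borel)) (\<lambda>\<omega> i. Y i \<omega>)"
proof -
  have [measurable]: "Y i \<in> borel_measurable M" for i
    using indep by (simp add: indep_vars_def)
  have "indep_vars (\<lambda>_. borel) (\<lambda>i. Y (Suc i)) UNIV"
  proof -
    have "indep_vars (\<lambda>j. PiM {Suc j} (\<lambda>_. borel)) (\<lambda>j \<omega>. restrict (\<lambda>i. Y i \<omega>) {Suc j}) UNIV"
      by (intro indep_vars_restrict[OF indep]) (auto simp: disjoint_family_on_def)
    from indep_vars_compose2[OF this, of "\<lambda>j f. f (Suc j)" "\<lambda>_. borel"] show ?thesis
      by simp
  qed
  then have "distr M (PiM UNIV (\<lambda>_. borel)) (\<lambda>\<omega> i. Y (Suc i) \<omega>) =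
      PiM UNIV (\<lambda>i. distr M borel (Y (Suc i)))"
    using indep_vars_iff_distr_eq_PiM[of UNIV "\<lambda>i. Y (Suc i)" "\<lambda>_. borel"]
    by (simp add: restrict_def)
  also have "\<dots> = PiM UNIV (\<lambda>i. distr M borel (Y i))"
    using ident by metis
  also have "\<dots> = distr M (PiM UNIV (\<lambda>_. borel)) (\<lambda>\<omega> i. Y i \<omega>)"
    using indep_vars_iff_distr_eq_PiM[of UNIV Y "\<lambda>_. borel"] indep
    by (simp add: restrict_def)
  finally show ?thesis .
qed

lemma indep_var_head_tail:
  fixes Y :: "nat \<Rightarrow> 'a \<Rightarrow> real" and g :: "(nat \<Rightarrow> real) \<Rightarrow> real"
  assumes indep: "indep_vars (\<lambda>_. borel) Y UNIV"
    and g [measurable]: "g \<in> borel_measurable (PiM UNIV (\<lambda>_. borel))"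
  shows "indep_var borel (Y 0) borel (\<lambda>\<omega>. g (\<lambda>i. Y (Suc i) \<omega>))"
proof -
  have "indep_var (PiM {0} (\<lambda>_. borel)) (\<lambda>\<omega>. restrict (\<lambda>i. Y i \<omega>) {0})
          (PiM {1..} (\<lambda>_. borel)) (\<lambda>\<omega>. restrict (\<lambda>i. Y i \<omega>) {1..})"
    by (rule indep_var_restrict[OF indep]) auto
  moreover have "(\<lambda>x. x 0) \<in> measurable (PiM {0::nat} (\<lambda>_. borel :: real measure)) borel"
    by (intro measurable_component_singleton) simp
  moreover have "(\<lambda>x. g (\<lambda>i. x (Suc i))) \<in> borel_measurable (PiM {1..} (\<lambda>_. borel))"
    by (intro measurable_compose[OF _ g] measurable_abs_UNIV measurable_component_singleton) simp
  ultimately have "indep_var borel ((\<lambda>x. x 0) \<circ> (\<lambda>\<omega>. restrict (\<lambda>i. Y i \<omega>) {0}))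
     borel ((\<lambda>x. g (\<lambda>i. x (Suc i))) \<circ> (\<lambda>\<omega>. restrict (\<lambda>i. Y i \<omega>) {1..}))"
    by (rule indep_var_compose)
  then show ?thesis by (simp add: comp_def)
qed

text \<open>Let \<open>U\<close> be the event that the partial sums are unbounded above and \<open>M\<^sub>n\<close> the maximum of the
  first \<open>n\<close> of them, with \<open>M'\<^sub>n\<close> the same quantity for the shifted sequence. The recursion gives
  \<open>M\<^sub>n\<^sub>+\<^sub>1 - M'\<^sub>n = max Y\<^sub>0 (- M'\<^sub>n)\<close>. On the shift-invariant event \<open>U\<close> the left side has the mean of
  \<open>M\<^sub>n\<^sub>+\<^sub>1 - M\<^sub>n \<ge> 0\<close>, while the right side tends to \<open>Y\<^sub>0\<close> because \<open>M'\<^sub>n \<rightarrow> \<infinity>\<close> there. Hence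
  \<open>E(Y\<^sub>0; U) \<ge> 0\<close>. Since \<open>U\<close> is independent of \<open>Y\<^sub>0\<close>, this says \<open>E(Y\<^sub>0) P(U) \<ge> 0\<close>, which forces
  \<open>P(U) = 0\<close>.\<close>
lemma negative_drift_sums_bounded_above:
  fixes Y :: "nat \<Rightarrow> 'a \<Rightarrow> real"
  assumes indep: "indep_vars (\<lambda>_. borel) Y UNIV"
    and ident: "\<And>n. distr M borel (Y n) = distr M borel (Y 0)"
    and int: "integrable M (Y 0)"
    and neg: "expectation (Y 0) < 0"
  shows "AE \<omega> in M. \<exists>B. \<forall>k. (\<Sum>i<k. Y i \<omega>) \<le> B"
proof -
  let ?S = "PiM UNIV (\<lambda>_::nat. borel :: real measure)"
  define U where "U = unbounded_above_sums"
  define Z where "Z = (\<lambda>\<omega> i. Y i \<omega>)"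
  define Z' where "Z' = (\<lambda>\<omega> i. Y (Suc i) \<omega>)"
  have Y [measurable]: "Y i \<in> borel_measurable M" for i
    using indep by (simp add: indep_vars_def)
  have Z [measurable]: "Z \<in> measurable M ?S" "Z' \<in> measurable M ?S"
    unfolding Z_def Z'_def by (intro measurable_abs_UNIV Y)+
  have U [measurable]: "U \<in> sets ?S" unfolding U_def by measurable
  have ZU: "Z' \<omega> \<in> U \<longleftrightarrow> Z \<omega> \<in> U" for \<omega>
    unfolding U_def Z_def Z'_def by (rule unbounded_above_sums_shift)
  have law: "distr M ?S Z' = distr M ?S Z"
    unfolding Z_def Z'_def by (rule distr_sequence_shift[OF indep ident])
  have intY: "integrable M (Y i)" for i
    using ident Y Y int by (rule distr_eq_integrable)
  let ?m = "\<lambda>n x. max_partial_sum n x * indicator U x :: real"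
  have intm: "integrable M (\<lambda>\<omega>. ?m n (Z \<omega>))" for n
  proof (rule Bochner_Integration.integrable_bound)
    show "integrable M (\<lambda>\<omega>. \<Sum>i<n. \<bar>Y i \<omega>\<bar>)" using intY by simp
    show "AE \<omega> in M. norm (?m n (Z \<omega>)) \<le> norm (\<Sum>i<n. \<bar>Y i \<omega>\<bar>)"
      using max_partial_sum_le_sum_abs[of n "Z _"] max_partial_sum_nonneg[of n "Z _"]
      by (auto simp: indicator_def Z_def sum_nonneg)
  qed measurable
  have intm': "integrable M (\<lambda>\<omega>. ?m n (Z' \<omega>))"
    and int_eq: "(\<integral>\<omega>. ?m n (Z' \<omega>) \<partial>M) = (\<integral>\<omega>. ?m n (Z \<omega>) \<partial>M)" for n
  proof -
    have "integrable (distr M ?S Z) (?m n)" using intm by (subst integrable_distr_eq) auto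
    then show "integrable M (\<lambda>\<omega>. ?m n (Z' \<omega>))"
      unfolding law[symmetric] by (subst (asm) integrable_distr_eq) auto
    have "(\<integral>\<omega>. ?m n (Z' \<omega>) \<partial>M) = integral\<^sup>L (distr M ?S Z') (?m n)" by (subst integral_distr) auto
    also have "\<dots> = (\<integral>\<omega>. ?m n (Z \<omega>) \<partial>M)" unfolding law by (subst integral_distr) auto
    finally show "(\<integral>\<omega>. ?m n (Z' \<omega>) \<partial>M) = (\<integral>\<omega>. ?m n (Z \<omega>) \<partial>M)" .
  qed
  let ?D = "\<lambda>n \<omega>. max (Y 0 \<omega>) (- max_partial_sum n (Z' \<omega>)) * indicator U (Z' \<omega>)"
  have D_eq: "?D n \<omega> = ?m (Suc n) (Z \<omega>) - ?m n (Z' \<omega>)" for n \<omega>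
  proof -
    have "max_partial_sum (Suc n) (Z \<omega>) = max 0 (Y 0 \<omega> + max_partial_sum n (Z' \<omega>))"
      by (simp add: Z_def Z'_def)
    then show ?thesis using ZU[of \<omega>] by (auto simp: indicator_def)
  qed
  \<comment> \<open>Shift invariance of the law replaces \<open>Z'\<close> by \<open>Z\<close>, after which monotonicity of the maximum
    in \<open>n\<close> applies.\<close>
  have D_nonneg: "0 \<le> expectation (?D n)" for n
  proof -
    have "expectation (?D n) = (\<integral>\<omega>. ?m (Suc n) (Z \<omega>) \<partial>M) - (\<integral>\<omega>. ?m n (Z \<omega>) \<partial>M)"
      unfolding D_eq using intm intm' by (simp only: Bochner_Integration.integral_diff int_eq)
    moreover have "(\<integral>\<omega>. ?m n (Z \<omega>) \<partial>M) \<le> (\<integral>\<omega>. ?m (Suc n) (Z \<omega>) \<partial>M)"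
      by (intro integral_mono intm mult_right_mono max_partial_sum_le_Suc) auto
    ultimately show ?thesis by simp
  qed
  \<comment> \<open>Because \<open>M'\<^sub>n \<ge> 0\<close>, the truncation of \<open>Y\<^sub>0\<close> from below is dominated by \<open>|Y\<^sub>0|\<close>.\<close>
  have "(\<lambda>n. expectation (?D n)) \<longlonglongrightarrow> expectation (\<lambda>\<omega>. Y 0 \<omega> * indicator U (Z' \<omega>))"
  proof (rule integral_dominated_convergence)
    show "integrable M (\<lambda>\<omega>. \<bar>Y 0 \<omega>\<bar>)" using int by simp
    have "norm (?D n \<omega>) \<le> \<bar>Y 0 \<omega>\<bar>" for n \<omega>
      using max_partial_sum_nonneg[of n "Z' \<omega>"] by (auto simp: indicator_def)
    then show "AE \<omega> in M. norm (?D n \<omega>) \<le> \<bar>Y 0 \<omega>\<bar>" for n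
      by (intro AE_I2)
    show "AE \<omega> in M. (\<lambda>n. ?D n \<omega>) \<longlonglongrightarrow> Y 0 \<omega> * indicator U (Z' \<omega>)"
    proof (intro AE_I2)
      fix \<omega>
      have "eventually (\<lambda>n. ?D n \<omega> = Y 0 \<omega> * indicator U (Z' \<omega>)) sequentially"
      proof (cases "Z' \<omega> \<in> U")
        case True
        obtain B :: nat where B: "- Y 0 \<omega> \<le> real B" using real_arch_simple by blast
        from True obtain k where k: "real B < (\<Sum>i<k. Z' \<omega> i)"
          by (auto simp: U_def unbounded_above_sums_def)
        have "- max_partial_sum n (Z' \<omega>) \<le> Y 0 \<omega>" if "k \<le> n" for n
          using sum_le_max_partial_sum[OF that, of "Z' \<omega>"] k B by linarith
        then show ?thesis
          unfolding eventually_sequentially by (metis max_absorb1)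
      qed simp
      then show "(\<lambda>n. ?D n \<omega>) \<longlonglongrightarrow> Y 0 \<omega> * indicator U (Z' \<omega>)"
        by (rule tendsto_eventually)
    qed
  qed measurable
  then have "0 \<le> expectation (\<lambda>\<omega>. Y 0 \<omega> * indicator U (Z' \<omega>))"
    by (rule LIMSEQ_le_const) (use D_nonneg in blast)
  also have "\<dots> = expectation (Y 0) * expectation (\<lambda>\<omega>. indicator U (Z' \<omega>))"
  proof (rule indep_var_lebesgue_integral)
    show "indep_var borel (Y 0) borel (\<lambda>\<omega>. indicator U (Z' \<omega>) :: real)"
      unfolding Z'_def by (rule indep_var_head_tail[OF indep]) measurable
    show "integrable M (\<lambda>\<omega>. indicator U (Z' \<omega>) :: real)"
      by (rule integrable_const_bound[of _ 1]) (auto simp: indicator_def)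
  qed (fact int)
  finally have "expectation (\<lambda>\<omega>. indicator U (Z' \<omega>)) \<le> (0::real)"
    using neg by (simp add: zero_le_mult_iff)
  moreover have "integrable M (\<lambda>\<omega>. indicator U (Z' \<omega>) :: real)"
    by (rule integrable_const_bound[of _ 1]) (auto simp: indicator_def)
  moreover have "0 \<le> expectation (\<lambda>\<omega>. indicator U (Z' \<omega>) :: real)" by simp
  ultimately have "AE \<omega> in M. indicator U (Z' \<omega>) = (0::real)"
    by (subst integral_nonneg_eq_0_iff_AE[symmetric]) auto
  then show ?thesis
  proof eventually_elim
    case (elim \<omega>)
    then have "Z \<omega> \<notin> U" using ZU by (auto simp: indicator_def split: if_splits)
    then obtain B :: nat where "\<And>k. \<not> real B < (\<Sum>i<k. Y i \<omega>)"
      by (auto simp: U_def unbounded_above_sums_def Z_def)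
    then have "\<forall>k. (\<Sum>i<k. Y i \<omega>) \<le> real B" by (simp add: not_less)
    then show ?case by blast
  qed
qed

text \<open>Centering at any \<open>c\<close> above the mean produces negative drift.\<close>
lemma sums_le_linear:
  fixes Y :: "nat \<Rightarrow> 'a \<Rightarrow> real"
  assumes indep: "indep_vars (\<lambda>_. borel) Y UNIV"
    and ident: "\<And>n. distr M borel (Y n) = distr M borel (Y 0)"
    and int: "integrable M (Y 0)"
    and c: "expectation (Y 0) < c"
  shows "AE \<omega> in M. \<exists>B. \<forall>k. (\<Sum>i<k. Y i \<omega>) \<le> c * real k + B"
proof -
  have [measurable]: "Y i \<in> borel_measurable M" for i
    using indep by (simp add: indep_vars_def)
  have "AE \<omega> in M. \<exists>B. \<forall>k. (\<Sum>i<k. Y i \<omega> - c) \<le> B"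
  proof (rule negative_drift_sums_bounded_above)
    show "indep_vars (\<lambda>_. borel) (\<lambda>i \<omega>. Y i \<omega> - c) UNIV"
      by (rule indep_vars_compose2[OF indep]) auto
    show "distr M borel (\<lambda>\<omega>. Y n \<omega> - c) = distr M borel (\<lambda>\<omega>. Y 0 \<omega> - c)" for n
      by (rule distr_eq_compose[OF ident]) measurable
    show "integrable M (\<lambda>\<omega>. Y 0 \<omega> - c)" using int by simp
    show "expectation (\<lambda>\<omega>. Y 0 \<omega> - c) < 0" using int c by (simp add: prob_space)
  qed
  then show ?thesis
    by eventually_elim (auto simp: sum_subtractf algebra_simps)
qed

text \<open>The linear bounds with slopes \<open>\<mu> + \<epsilon>\<close> for the sums and \<open>- \<mu> + \<epsilon>\<close> for their negatives hold
  simultaneously for all \<open>\<epsilon> = 1/(j + 1)\<close>; the additive constants vanish after division by \<open>n\<close>.\<close>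
lemma strong_law_real:
  fixes Y :: "nat \<Rightarrow> 'a \<Rightarrow> real"
  assumes indep: "indep_vars (\<lambda>_. borel) Y UNIV"
    and ident: "\<And>n. distr M borel (Y n) = distr M borel (Y 0)"
    and int: "integrable M (Y 0)"
  shows "AE \<omega> in M. (\<lambda>n. (\<Sum>i<n. Y i \<omega>) / real n) \<longlonglongrightarrow> expectation (Y 0)"
proof -
  let ?\<mu> = "expectation (Y 0)"
  have [measurable]: "Y i \<in> borel_measurable M" for i
    using indep by (simp add: indep_vars_def)
  have upper: "AE \<omega> in M. \<exists>B. \<forall>k. (\<Sum>i<k. Y i \<omega>) \<le> (?\<mu> + 1 / Suc j) * real k + B" for j
    by (rule sums_le_linear[OF indep ident int]) simp
  have lower: "AE \<omega> in M. \<exists>B. \<forall>k. (\<Sum>i<k. - Y i \<omega>) \<le> (- ?\<mu> + 1 / Suc j) * real k + B" for j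
  proof (rule sums_le_linear)
    show "indep_vars (\<lambda>_. borel) (\<lambda>i \<omega>. - Y i \<omega>) UNIV"
      by (rule indep_vars_compose2[OF indep]) auto
    show "distr M borel (\<lambda>\<omega>. - Y n \<omega>) = distr M borel (\<lambda>\<omega>. - Y 0 \<omega>)" for n
      by (rule distr_eq_compose[OF ident]) measurable
  qed (use int in auto)
  from upper lower have "AE \<omega> in M. \<forall>j. (\<exists>B. \<forall>k. (\<Sum>i<k. Y i \<omega>) \<le> (?\<mu> + 1 / Suc j) * real k + B)
      \<and> (\<exists>B. \<forall>k. (\<Sum>i<k. - Y i \<omega>) \<le> (- ?\<mu> + 1 / Suc j) * real k + B)"
    by (simp add: AE_all_countable)
  then show ?thesis
  proof eventually_elim
    case (elim \<omega>)
    show ?case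
    proof (rule LIMSEQ_I)
      fix r :: real assume r: "0 < r"
      then obtain j where j: "1 / real (Suc j) < r / 2" using nat_approx_posE half_gt_zero by metis
      obtain B1 where B1: "\<And>k. (\<Sum>i<k. Y i \<omega>) \<le> (?\<mu> + 1 / Suc j) * real k + B1" using elim by blast
      obtain B2 where B2: "\<And>k. (\<Sum>i<k. - Y i \<omega>) \<le> (- ?\<mu> + 1 / Suc j) * real k + B2" using elim by blast
      obtain N :: nat where N: "2 * (\<bar>B1\<bar> + \<bar>B2\<bar>) / r < real N" using reals_Archimedean2 by blast
      have "norm ((\<Sum>i<n. Y i \<omega>) / real n - ?\<mu>) < r" if "n \<ge> Suc N" for n
      proof -
        have n: "real n > 0" using that by simp
        have "2 * (\<bar>B1\<bar> + \<bar>B2\<bar>) / r < real n" using N that by linarith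
        then have b: "\<bar>B1\<bar> + \<bar>B2\<bar> < r * real n / 2" using r by (simp add: field_simps)
        have "1 / real (Suc j) * real n \<le> r / 2 * real n" using j by (intro mult_right_mono) auto
        then have j': "1 / real (Suc j) * real n \<le> r * real n / 2" by simp
        have "(\<Sum>i<n. Y i \<omega>) \<le> ?\<mu> * real n + 1 / real (Suc j) * real n + B1"
          using B1[of n] by (simp only: distrib_right)
        then have "(\<Sum>i<n. Y i \<omega>) - ?\<mu> * real n < r * real n"
          using j' b by linarith
        moreover have "- (\<Sum>i<n. Y i \<omega>) \<le> - (?\<mu> * real n) + 1 / real (Suc j) * real n + B2"
          using B2[of n] by (simp only: distrib_right sum_negf minus_mult_left)
        then have "- (r * real n) < (\<Sum>i<n. Y i \<omega>) - ?\<mu> * real n"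
          using j' b by linarith
        ultimately have "\<bar>(\<Sum>i<n. Y i \<omega>) - ?\<mu> * real n\<bar> < r * real n" by linarith
        moreover have "(\<Sum>i<n. Y i \<omega>) / real n - ?\<mu> = ((\<Sum>i<n. Y i \<omega>) - ?\<mu> * real n) / real n"
          using n by (simp add: field_simps)
        ultimately show ?thesis using n by (simp add: field_simps)
      qed
      then show "\<exists>N. \<forall>n\<ge>N. norm ((\<Sum>i<n. Y i \<omega>) / real n - ?\<mu>) < r" by blast
    qed
  qed
qed

theorem strong_law_of_large_numbers:
  fixes Y :: "nat \<Rightarrow> 'a \<Rightarrow> 'b::euclidean_space"
  assumes indep: "indep_vars (\<lambda>_. borel) Y UNIV"
    and ident: "\<And>n. distr M borel (Y n) = distr M borel (Y 0)"
    and int: "integrable M (Y 0)"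
  shows "AE \<omega> in M. (\<lambda>n. (1 / real n) *\<^sub>R (\<Sum>i<n. Y i \<omega>)) \<longlonglongrightarrow> expectation (Y 0)"
proof -
  have [measurable]: "Y i \<in> borel_measurable M" for i
    using indep by (simp add: indep_vars_def)
  have "AE \<omega> in M. \<forall>b\<in>Basis. (\<lambda>n. (\<Sum>i<n. Y i \<omega> \<bullet> b) / real n) \<longlonglongrightarrow> expectation (\<lambda>\<omega>. Y 0 \<omega> \<bullet> b)"
  proof (intro AE_ball_countable[THEN iffD2] ballI countable_finite finite_Basis strong_law_real)
    fix b :: 'b
    show "indep_vars (\<lambda>_. borel) (\<lambda>i \<omega>. Y i \<omega> \<bullet> b) UNIV"
      by (rule indep_vars_compose2[OF indep]) auto
    show "distr M borel (\<lambda>\<omega>. Y n \<omega> \<bullet> b) = distr M borel (\<lambda>\<omega>. Y 0 \<omega> \<bullet> b)" for n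
      by (rule distr_eq_compose[OF ident]) measurable
    show "integrable M (\<lambda>\<omega>. Y 0 \<omega> \<bullet> b)" using int by simp
  qed
  then show ?thesis
    by eventually_elim
      (subst tendsto_componentwise_iff, use int in \<open>simp add: inner_sum_left\<close>)
qed

end

section \<open>Tail probabilities and the second Borel--Cantelli lemma\<close>

context prob_space
begin

text \<open>The series is the expectation of \<open>\<lceil>Z/c\<rceil>\<close>, and \<open>Z \<le> c\<lceil>Z/c\<rceil> \<le> Z + c\<close>.\<close>
lemma summable_prob_tail_iff:
  fixes Z :: "'a \<Rightarrow> real"
  assumes Z [measurable]: "Z \<in> borel_measurable M" and c: "0 < c"
    and nonneg: "\<And>\<omega>. 0 \<le> Z \<omega>"
  shows "summable (\<lambda>n. prob {\<omega>\<in>space M. c * real n < Z \<omega>}) \<longleftrightarrow> (\<integral>\<^sup>+\<omega>. ennreal (Z \<omega>) \<partial>M) < \<infinity>"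
proof -
  define N where "N \<omega> = nat \<lceil>Z \<omega> / c\<rceil>" for \<omega>
  have [measurable]: "N \<in> measurable M (count_space UNIV)" unfolding N_def by measurable
  have less_N: "n < N \<omega> \<longleftrightarrow> c * real n < Z \<omega>" for n \<omega>
  proof -
    have "n < N \<omega> \<longleftrightarrow> real n < Z \<omega> / c"
      unfolding N_def by (simp add: zless_nat_eq_int_zless less_ceiling_iff)
    also have "\<dots> \<longleftrightarrow> c * real n < Z \<omega>" using c by (simp add: field_simps)
    finally show ?thesis .
  qed
  have tails: "(\<integral>\<^sup>+\<omega>. of_nat (N \<omega>) \<partial>M) = (\<Sum>n. ennreal (prob {\<omega>\<in>space M. c * real n < Z \<omega>}))"
    by (subst nn_integral_nat_function) (simp_all add: less_N emeasure_eq_measure)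
  have lower: "ennreal (Z \<omega>) \<le> ennreal c * of_nat (N \<omega>)" for \<omega>
  proof -
    have "Z \<omega> \<le> c * real (N \<omega>)" using less_N[of "N \<omega>" \<omega>] by simp
    then show ?thesis
      using c by (simp add: ennreal_of_nat_eq_real_of_nat ennreal_mult[symmetric] ennreal_leI)
  qed
  have upper: "ennreal c * of_nat (N \<omega>) \<le> ennreal (Z \<omega>) + ennreal c" for \<omega>
  proof -
    have "c * real (N \<omega>) \<le> Z \<omega> + c"
    proof (cases "N \<omega>")
      case (Suc n)
      then show ?thesis using less_N[of n \<omega>] by (simp add: algebra_simps)
    qed (use c nonneg[of \<omega>] in simp)
    then show ?thesis
      using c nonneg[of \<omega>]
      by (simp add: ennreal_of_nat_eq_real_of_nat ennreal_mult[symmetric] ennreal_plus[symmetric] ennreal_leI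
               del: ennreal_plus)
  qed
  show ?thesis
  proof
    assume "summable (\<lambda>n. prob {\<omega>\<in>space M. c * real n < Z \<omega>})"
    then have "(\<integral>\<^sup>+\<omega>. of_nat (N \<omega>) \<partial>M) < top"
      unfolding tails by (subst less_top[symmetric]) (rule ennreal_suminf_neq_top, auto)
    moreover have "(\<integral>\<^sup>+\<omega>. ennreal (Z \<omega>) \<partial>M) \<le> (\<integral>\<^sup>+\<omega>. ennreal c * of_nat (N \<omega>) \<partial>M)"
      by (intro nn_integral_mono lower)
    moreover have "(\<integral>\<^sup>+\<omega>. ennreal c * of_nat (N \<omega>) \<partial>M) = ennreal c * (\<integral>\<^sup>+\<omega>. of_nat (N \<omega>) \<partial>M)"
      by (rule nn_integral_cmult) measurable
    ultimately show "(\<integral>\<^sup>+\<omega>. ennreal (Z \<omega>) \<partial>M) < \<infinity>"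
      by (simp add: ennreal_mult_less_top order.strict_trans1)
  next
    assume fin: "(\<integral>\<^sup>+\<omega>. ennreal (Z \<omega>) \<partial>M) < \<infinity>"
    have "ennreal c * (\<integral>\<^sup>+\<omega>. of_nat (N \<omega>) \<partial>M) = (\<integral>\<^sup>+\<omega>. ennreal c * of_nat (N \<omega>) \<partial>M)"
      by (rule nn_integral_cmult[symmetric]) measurable
    also have "\<dots> \<le> (\<integral>\<^sup>+\<omega>. ennreal (Z \<omega>) + ennreal c \<partial>M)"
      by (intro nn_integral_mono upper)
    also have "\<dots> = (\<integral>\<^sup>+\<omega>. ennreal (Z \<omega>) \<partial>M) + ennreal c"
      by (subst nn_integral_add) (auto simp: emeasure_space_1)
    also have "\<dots> < top" using fin by simp
    finally have "(\<integral>\<^sup>+\<omega>. of_nat (N \<omega>) \<partial>M) \<noteq> top"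
      using c by (auto simp: ennreal_mult_less_top)
    then show "summable (\<lambda>n. prob {\<omega>\<in>space M. c * real n < Z \<omega>})"
      unfolding tails by (intro summable_suminf_not_top) auto
  qed
qed

text \<open>The second Borel--Cantelli lemma. With \<open>q\<^sub>i\<close> the probability of the \<open>i\<close>-th event, independence
  bounds the probability that none of the events from \<open>n\<close> on occurs by the products of
  \<open>1 - q\<^sub>i \<le> exp (- q\<^sub>i)\<close>; if it were positive, the partial sums of \<open>q\<close> would be bounded.\<close>
lemma indep_vars_frequently:
  fixes Y :: "nat \<Rightarrow> 'a \<Rightarrow> 'b"
  assumes indep: "indep_vars N Y UNIV" and B: "\<And>i. B i \<in> sets (N i)"
    and div: "\<not> summable (\<lambda>i. prob (Y i -` B i \<inter> space M))"
  shows "AE \<omega> in M. \<exists>\<^sub>F i in sequentially. Y i \<omega> \<in> B i"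
proof -
  have Y: "Y i \<in> measurable M (N i)" for i using indep by (simp add: indep_vars_def)
  define q where "q i = prob (Y i -` B i \<inter> space M)" for i
  define C where "C n = {\<omega>\<in>space M. \<forall>i\<ge>n. Y i \<omega> \<notin> B i}" for n
  have ev: "Y i -` B i \<inter> space M \<in> events" for i using Y B by (rule measurable_sets)
  have C_eq: "C n = (\<Inter>i\<in>{n..}. space M - (Y i -` B i \<inter> space M))" for n
    by (auto simp: C_def)
  have C: "C n \<in> events" for n unfolding C_eq using ev by (intro sets.countable_INT') auto
  have bound: "prob (C n) \<le> exp (- (\<Sum>i<m. q (i + n)))" for n m
  proof -
    have comp: "Y i -` (space (N i) - B i) \<inter> space M = space M - (Y i -` B i \<inter> space M)" for i
      using measurable_space[OF Y[of i]] by auto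
    have "prob (C n) \<le> prob (\<Inter>i\<in>{n..n + m}. Y i -` (space (N i) - B i) \<inter> space M)"
      unfolding C_eq comp using ev by (intro finite_measure_mono sets.finite_INT) auto
    also have "\<dots> = (\<Prod>i\<in>{n..n + m}. prob (Y i -` (space (N i) - B i) \<inter> space M))"
      using B by (intro indep_varsD[OF indep]) auto
    also have "\<dots> = (\<Prod>i\<in>{n..n + m}. 1 - q i)"
      unfolding comp q_def using ev by (simp add: prob_compl)
    also have "\<dots> \<le> (\<Prod>i\<in>{n..n + m}. exp (- q i))"
    proof (intro prod_mono conjI)
      fix i
      show "0 \<le> 1 - q i" by (simp add: q_def)
      show "1 - q i \<le> exp (- q i)" using exp_ge_add_one_self[of "- q i"] by simp
    qed
    also have "\<dots> = exp (- (\<Sum>i\<in>{n..n + m}. q i))" by (simp add: exp_sum sum_negf[symmetric])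
    also have "\<dots> \<le> exp (- (\<Sum>i<m. q (i + n)))"
    proof -
      have "(\<Sum>i<m. q (i + n)) = (\<Sum>i\<in>{n..<m + n}. q i)"
        using sum.shift_bounds_nat_ivl[of q 0 n m] by (simp add: lessThan_atLeast0)
      also have "\<dots> \<le> (\<Sum>i\<in>{n..n + m}. q i)" by (intro sum_mono2) (auto simp: q_def)
      finally show ?thesis by simp
    qed
    finally show ?thesis .
  qed
  have C0: "prob (C n) = 0" for n
  proof (rule ccontr)
    assume "prob (C n) \<noteq> 0"
    then have pos: "prob (C n) > 0" by (simp add: zero_less_measure_iff)
    have "(\<Sum>i<m. q (i + n)) \<le> - ln (prob (C n))" for m
      using bound[of n m] pos by (metis ln_exp ln_le_cancel_iff exp_gt_zero le_minus_iff)
    then have "summable (\<lambda>i. q (i + n))"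
      by (intro summableI_nonneg_bounded) (auto simp: q_def)
    then have "summable q" by (simp add: summable_iff_shift)
    with div show False by (simp add: q_def[abs_def])
  qed
  have "AE \<omega> in M. \<omega> \<notin> C n" for n
    using C0[of n] C[of n] by (simp add: prob_eq_0)
  then have "AE \<omega> in M. \<forall>n. \<omega> \<notin> C n" by (simp add: AE_all_countable)
  then show ?thesis
    using AE_space by eventually_elim (auto simp: C_def frequently_sequentially)
qed

lemma prob_tail_tendsto_0:
  fixes Z :: "'a \<Rightarrow> real"
  assumes [measurable]: "Z \<in> borel_measurable M"
  shows "(\<lambda>n. prob {\<omega>\<in>space M. real n < Z \<omega>}) \<longlonglongrightarrow> 0"
proof -
  let ?A = "\<lambda>n. {\<omega>\<in>space M. real n < Z \<omega>}"
  have "(\<lambda>n. prob (?A n)) \<longlonglongrightarrow> prob (\<Inter>n. ?A n)"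
    by (rule finite_Lim_measure_decseq) (auto simp: decseq_def)
  moreover have "(\<Inter>n. ?A n) = {}"
    by auto (meson less_asym reals_Archimedean2)
  ultimately show ?thesis by simp
qed

lemma prob_norm_eq_if_distr_eq:
  fixes U V :: "'a \<Rightarrow> 'b::euclidean_space"
  assumes eq: "distr M borel U = distr M borel V"
    and [measurable]: "U \<in> borel_measurable M" "V \<in> borel_measurable M"
  shows "prob {\<omega>\<in>space M. a < norm (U \<omega>)} = prob {\<omega>\<in>space M. a < norm (V \<omega>)}"
proof -
  have "prob {\<omega>\<in>space M. a < norm (W \<omega>)} = measure (distr M borel W) {x. a < norm x}"
    if [measurable]: "W \<in> borel_measurable M" for W :: "'a \<Rightarrow> 'b"
    by (subst measure_distr) (auto intro!: arg_cong[where f=prob])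
  then show ?thesis using eq by simp
qed

end

section \<open>Ottaviani's maximal inequality\<close>

context prob_space
begin

text \<open>Decompose according to the first index \<open>k\<close> at which the partial sum exceeds \<open>2a\<close>. This event is
  determined by the summands before \<open>k\<close>, hence independent of the remaining sum, which is at
  most \<open>a\<close> with probability at least one half; and when both happen the full sum exceeds \<open>a\<close>.\<close>
lemma ottaviani_inequality:
  fixes D :: "nat \<Rightarrow> 'a \<Rightarrow> 'b::euclidean_space"
  assumes indep: "indep_vars (\<lambda>_. borel) D {..<N}"
    and remainder: "\<And>k. k \<le> N \<Longrightarrow> prob {\<omega>\<in>space M. a < norm (\<Sum>i\<in>{k..<N}. D i \<omega>)} \<le> 1 / 2"
  shows "prob {\<omega>\<in>space M. \<exists>k\<le>N. 2 * a < norm (\<Sum>i<k. D i \<omega>)}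
          \<le> 2 * prob {\<omega>\<in>space M. a < norm (\<Sum>i<N. D i \<omega>)}"
proof -
  have D: "D i \<in> borel_measurable M" if "i < N" for i
    using indep that by (simp add: indep_vars_def)
  have sums: "(\<lambda>\<omega>. norm (\<Sum>i\<in>I. D i \<omega>)) \<in> borel_measurable M" if "I \<subseteq> {..<N}" for I
    using that by (intro measurable_compose[OF _ borel_measurable_norm] borel_measurable_sum D) auto
  define A where
    "A k = {\<omega>\<in>space M. 2 * a < norm (\<Sum>i<k. D i \<omega>) \<and> (\<forall>j\<in>{..<k}. norm (\<Sum>i<j. D i \<omega>) \<le> 2 * a)}" for k
  define B where "B k = {\<omega>\<in>space M. norm (\<Sum>i\<in>{k..<N}. D i \<omega>) \<le> a}" for k
  define E where "E = {\<omega>\<in>space M. a < norm (\<Sum>i<N. D i \<omega>)}"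
  have E: "E \<in> events"
    unfolding E_def by (intro borel_measurable_less sums borel_measurable_const) auto
  have B: "B k \<in> events" for k
    unfolding B_def by (intro borel_measurable_le sums borel_measurable_const) auto
  let ?P = "\<lambda>I. PiM I (\<lambda>_::nat. borel :: 'b measure)"
  define A' where
    "A' k = {x\<in>space (?P {..<k}). 2 * a < norm (\<Sum>i<k. x i) \<and> (\<forall>j\<in>{..<k}. norm (\<Sum>i<j. x i) \<le> 2 * a)}" for k
  define B' where "B' k = {x\<in>space (?P {k..<N}). norm (\<Sum>i\<in>{k..<N}. x i) \<le> a}" for k
  have coord: "(\<lambda>x. norm (\<Sum>i\<in>J. x i)) \<in> borel_measurable (?P I)" if "J \<subseteq> I" for I J
    using that
    by (intro measurable_compose[OF _ borel_measurable_norm] borel_measurable_sum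
              measurable_component_singleton) auto
  have A': "A' k \<in> sets (?P {..<k})" for k
    unfolding A'_def
    by (intro sets.sets_Collect_conj sets.sets_Collect_finite_All borel_measurable_less borel_measurable_le
              coord borel_measurable_const) auto
  have B': "B' k \<in> sets (?P {k..<N})" for k
    unfolding B'_def
    by (intro borel_measurable_le coord borel_measurable_const) auto
  have A_eq: "A k = (\<lambda>\<omega>. restrict (\<lambda>i. D i \<omega>) {..<k}) -` A' k \<inter> space M" for k
    by (auto simp: A_def A'_def space_PiM intro!: sum.cong)
  have B_eq: "B k = (\<lambda>\<omega>. restrict (\<lambda>i. D i \<omega>) {k..<N}) -` B' k \<inter> space M" for k
    by (auto simp: B_def B'_def space_PiM)
  have A: "A k \<in> events" if "k \<le> N" for k
    unfolding A_eq using that by (intro measurable_sets[OF _ A'] measurable_restrict D) auto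
  have half: "prob (A k) \<le> 2 * prob (A k \<inter> B k)" if k: "k \<le> N" for k
  proof -
    have "indep_var (?P {..<k}) (\<lambda>\<omega>. restrict (\<lambda>i. D i \<omega>) {..<k})
                    (?P {k..<N}) (\<lambda>\<omega>. restrict (\<lambda>i. D i \<omega>) {k..<N})"
      using k by (intro indep_var_restrict[OF indep]) auto
    from indep_varD[OF this A' B'] have "prob (A k \<inter> B k) = prob (A k) * prob (B k)"
      unfolding A_eq B_eq by (simp add: vimage_Times comp_def Int_ac)
    moreover have "prob (B k) \<ge> 1 / 2"
    proof -
      have "B k = space M - {\<omega>\<in>space M. a < norm (\<Sum>i\<in>{k..<N}. D i \<omega>)}"
        by (auto simp: B_def)
      moreover have "{\<omega>\<in>space M. a < norm (\<Sum>i\<in>{k..<N}. D i \<omega>)} \<in> events"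
        by (intro borel_measurable_less sums borel_measurable_const) auto
      ultimately show ?thesis using remainder[OF k] by (simp add: prob_compl)
    qed
    then have "prob (A k) * (1 / 2) \<le> prob (A k) * prob (B k)" by (intro mult_left_mono) auto
    ultimately show ?thesis by simp
  qed
  have disj: "disjoint_family_on A {..N}"
  proof -
    have "A k \<inter> A l = {}" if "k < l" for k l using that by (force simp: A_def)
    then show ?thesis unfolding disjoint_family_on_def by (metis Int_commute linorder_neqE_nat)
  qed
  have "{\<omega>\<in>space M. \<exists>k\<le>N. 2 * a < norm (\<Sum>i<k. D i \<omega>)} \<subseteq> (\<Union>k\<in>{..N}. A k)"
  proof safe
    fix \<omega> k assume \<omega>: "\<omega> \<in> space M" and k: "k \<le> N" "2 * a < norm (\<Sum>i<k. D i \<omega>)"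
    define l where "l = (LEAST k. 2 * a < norm (\<Sum>i<k. D i \<omega>))"
    have "2 * a < norm (\<Sum>i<l. D i \<omega>)" unfolding l_def by (rule LeastI) (fact k(2))
    moreover have "norm (\<Sum>i<j. D i \<omega>) \<le> 2 * a" if "j < l" for j
      using not_less_Least[of j "\<lambda>k. 2 * a < norm (\<Sum>i<k. D i \<omega>)"] that by (simp add: l_def not_less)
    moreover have "l \<le> N" using Least_le[of "\<lambda>k. 2 * a < norm (\<Sum>i<k. D i \<omega>)" k] k by (simp add: l_def)
    ultimately show "\<omega> \<in> (\<Union>k\<in>{..N}. A k)" using \<omega> by (auto simp: A_def)
  qed
  then have "prob {\<omega>\<in>space M. \<exists>k\<le>N. 2 * a < norm (\<Sum>i<k. D i \<omega>)} \<le> prob (\<Union>k\<in>{..N}. A k)"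
    using A by (intro finite_measure_mono sets.finite_UN) auto
  also have "\<dots> = (\<Sum>k\<le>N. prob (A k))"
    using A disj by (intro finite_measure_finite_Union) auto
  also have "\<dots> \<le> (\<Sum>k\<le>N. 2 * prob (A k \<inter> B k))" by (intro sum_mono half) auto
  also have "\<dots> = 2 * (\<Sum>k\<le>N. prob (A k \<inter> B k))" by (simp add: sum_distrib_left)
  also have "(\<Sum>k\<le>N. prob (A k \<inter> B k)) = prob (\<Union>k\<in>{..N}. A k \<inter> B k)"
  proof (rule finite_measure_finite_Union[symmetric])
    show "disjoint_family_on (\<lambda>k. A k \<inter> B k) {..N}"
      using disj by (fastforce simp: disjoint_family_on_def)
  qed (use A B in auto)
  also have "prob (\<Union>k\<in>{..N}. A k \<inter> B k) \<le> prob E"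
  proof (intro finite_measure_mono E UN_least)
    fix k assume "k \<in> {..N}"
    then have split: "(\<Sum>i<N. D i \<omega>) = (\<Sum>i<k. D i \<omega>) + (\<Sum>i\<in>{k..<N}. D i \<omega>)" for \<omega>
      by (simp add: lessThan_atLeast0 sum.atLeastLessThan_concat)
    show "A k \<inter> B k \<subseteq> E"
    proof
      fix \<omega> assume \<omega>: "\<omega> \<in> A k \<inter> B k"
      have "norm (\<Sum>i<k. D i \<omega>) \<le> norm (\<Sum>i<N. D i \<omega>) + norm (\<Sum>i\<in>{k..<N}. D i \<omega>)"
        using norm_triangle_ineq4[of "\<Sum>i<N. D i \<omega>" "\<Sum>i\<in>{k..<N}. D i \<omega>"] by (simp add: split)
      with \<omega> show "\<omega> \<in> E" by (auto simp: A_def B_def E_def)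
    qed
  qed
  finally show ?thesis by (simp add: E_def)
qed

end

section \<open>Growth of a single path\<close>

text \<open>With \<open>N\<close> the number of whole periods completed before \<open>t\<close>,
  \<open>x(t)/t = (N/t) \<cdot> (x(Np)/N + (x(t) - x(Np))/N)\<close>, where \<open>N/t \<rightarrow> 1/p\<close> and the last term vanishes by
  the bound on the oscillation within a period.\<close>
lemma tendsto_scaled_process:
  fixes x :: "real \<Rightarrow> 'a::real_normed_vector"
  assumes p: "0 < p"
    and lim: "(\<lambda>n. (1 / real n) *\<^sub>R x (real n * p)) \<longlonglongrightarrow> \<mu>"
    and fluct: "\<And>c. 0 < c \<Longrightarrow> \<forall>\<^sub>F n in sequentially. \<forall>s\<in>{0..<p}. norm (x (real n * p + s) - x (real n * p)) \<le> c * real n"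
  shows "((\<lambda>t. (1 / t) *\<^sub>R x t) \<longlongrightarrow> (1 / p) *\<^sub>R \<mu>) at_top"
proof -
  define N where "N t = nat \<lfloor>t / p\<rfloor>" for t
  have N: "real (N t) = of_int \<lfloor>t / p\<rfloor>" if "0 \<le> t" for t using that p by (simp add: N_def)
  have scale: "filterlim (\<lambda>t. t / p) at_top at_top"
    using p by real_asymp
  have N_top: "filterlim N sequentially at_top"
    unfolding N_def
    by (rule filterlim_compose[OF filterlim_nat_sequentially
          filterlim_compose[OF filterlim_floor_sequentially scale]])
  have ratio: "((\<lambda>t. real (N t) / t) \<longlongrightarrow> 1 / p) at_top"
  proof (rule tendsto_sandwich[of "\<lambda>t. 1 / p - 1 / t" _ _ "\<lambda>t. 1 / p"])
    have "\<forall>\<^sub>F t in at_top. (0::real) < t" by (rule eventually_gt_at_top)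
    then show "\<forall>\<^sub>F t in at_top. 1 / p - 1 / t \<le> real (N t) / t"
    proof eventually_elim
      case (elim t)
      have "t / p - 1 \<le> real (N t)" using elim by (subst N) linarith+
      then have "(t / p - 1) / t \<le> real (N t) / t" using elim by (intro divide_right_mono) auto
      then show ?case using elim by (simp add: diff_divide_distrib)
    qed
    have "\<forall>\<^sub>F t in at_top. (0::real) < t" by (rule eventually_gt_at_top)
    then show "\<forall>\<^sub>F t in at_top. real (N t) / t \<le> 1 / p"
    proof eventually_elim
      case (elim t)
      have "real (N t) \<le> t / p" using elim by (subst N) linarith+
      then have "real (N t) / t \<le> (t / p) / t" using elim by (intro divide_right_mono) auto
      then show ?case using elim by simp
    qed
    show "((\<lambda>t. 1 / p - 1 / t) \<longlongrightarrow> 1 / p) at_top" by real_asymp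
  qed simp
  have remainder: "t = real (N t) * p + (t - real (N t) * p)" "t - real (N t) * p \<in> {0..<p}" if "0 < t" for t
  proof -
    have "real (N t) \<le> t / p" "t / p < real (N t) + 1" using that by (subst N; linarith)+
    then show "t - real (N t) * p \<in> {0..<p}" using p by (simp add: field_simps)
  qed simp
  have small: "((\<lambda>t. (1 / real (N t)) *\<^sub>R (x t - x (real (N t) * p))) \<longlongrightarrow> 0) at_top"
  proof (rule tendstoI)
    fix e :: real assume e: "0 < e"
    from fluct[of "e / 2"] e have
      "\<forall>\<^sub>F t in at_top. \<forall>s\<in>{0..<p}. norm (x (real (N t) * p + s) - x (real (N t) * p)) \<le> e / 2 * real (N t)"
      by (intro eventually_compose_filterlim[OF _ N_top]) auto
    moreover have "\<forall>\<^sub>F t in at_top. 0 < N t"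
      by (rule eventually_compose_filterlim[OF eventually_gt_at_top N_top])
    moreover have "\<forall>\<^sub>F t in at_top. (0::real) < t" by (rule eventually_gt_at_top)
    ultimately show "\<forall>\<^sub>F t in at_top. dist ((1 / real (N t)) *\<^sub>R (x t - x (real (N t) * p))) 0 < e"
    proof eventually_elim
      case (elim t)
      have "norm (x t - x (real (N t) * p)) \<le> e / 2 * real (N t)"
        using elim(1) remainder[OF elim(3)] by metis
      also have "\<dots> < e * real (N t)" using e elim(2) by simp
      finally have "norm (x t - x (real (N t) * p)) / real (N t) < e"
        using elim(2) by (simp add: divide_less_eq)
      then show ?case unfolding dist_norm diff_zero norm_scaleR by simp
    qed
  qed
  have "((\<lambda>t. (1 / real (N t)) *\<^sub>R x (real (N t) * p)) \<longlongrightarrow> \<mu>) at_top"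
    using filterlim_compose[OF lim N_top] by simp
  from tendsto_scaleR[OF ratio tendsto_add[OF this small]]
  have "((\<lambda>t. (real (N t) / t) *\<^sub>R ((1 / real (N t)) *\<^sub>R x (real (N t) * p)
          + (1 / real (N t)) *\<^sub>R (x t - x (real (N t) * p)))) \<longlongrightarrow> (1 / p) *\<^sub>R \<mu>) at_top"
    by simp
  moreover have "\<forall>\<^sub>F t in at_top. (real (N t) / t) *\<^sub>R ((1 / real (N t)) *\<^sub>R x (real (N t) * p)
          + (1 / real (N t)) *\<^sub>R (x t - x (real (N t) * p))) = (1 / t) *\<^sub>R x t"
  proof -
    have "\<forall>\<^sub>F t in at_top. 0 < N t"
      by (rule eventually_compose_filterlim[OF eventually_gt_at_top N_top])
    then show ?thesis
      by eventually_elim (simp add: scaleR_add_right[symmetric])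
  qed
  ultimately show ?thesis by (rule Lim_transform_eventually)
qed

text \<open>A finite upper limit would give \<open>|x(t)| \<le> Ct\<close> for large \<open>t\<close>, so that increments over the
  \<open>n\<close>-th period would be at most \<open>Cp(2n + 1) \<le> 3Cpn\<close>.\<close>
lemma Limsup_norm_eq_infinity:
  fixes x :: "real \<Rightarrow> 'a::real_normed_vector"
  assumes p: "0 < p"
    and large: "\<And>K::nat. \<exists>\<^sub>F n in sequentially. real (Suc K) * real n < norm (x (real (Suc n) * p) - x (real n * p))"
  shows "Limsup at_top (\<lambda>t. ereal ((1 / t) * norm (x t))) = \<infinity>"
proof (rule ccontr)
  assume "Limsup at_top (\<lambda>t. ereal ((1 / t) * norm (x t))) \<noteq> \<infinity>"
  then obtain C0 where "Limsup at_top (\<lambda>t. ereal ((1 / t) * norm (x t))) < ereal C0"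
    using less_PInf_Ex_of_nat by (metis ereal_infty_less(1))
  then have "\<forall>\<^sub>F t in at_top. ereal ((1 / t) * norm (x t)) < ereal C0" by (rule Limsup_lessD)
  then obtain t0 where t0: "\<And>t. t0 \<le> t \<Longrightarrow> (1 / t) * norm (x t) < C0"
    by (auto simp: eventually_at_top_linorder)
  \<comment> \<open>Nonnegativity is needed to enlarge \<open>2 n + 1\<close> to \<open>3 n\<close> below.\<close>
  define C where "C = max C0 0"
  have growth: "norm (x t) \<le> C * t" if "t0 \<le> t" "0 < t" for t
  proof -
    have "norm (x t) < C0 * t" using t0[OF that(1)] that(2) by (simp add: field_simps)
    also have "\<dots> \<le> C * t" using that(2) by (intro mult_right_mono) (auto simp: C_def)
    finally show ?thesis by simp
  qed
  obtain K :: nat where K: "3 * C * p \<le> real K" using real_arch_simple by blast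
  obtain m :: nat where m: "t0 / p \<le> real m" using real_arch_simple by blast
  obtain n where n: "Suc m \<le> n" and big: "real (Suc K) * real n < norm (x (real (Suc n) * p) - x (real n * p))"
    using large[of K] unfolding frequently_sequentially by blast
  have n1: "1 \<le> real n" using n by simp
  have "t0 \<le> real n * p"
  proof -
    have "t0 / p \<le> real n" using m n by linarith
    then show ?thesis using p by (simp add: field_simps)
  qed
  moreover have "real n * p \<le> real (Suc n) * p" using p by simp
  moreover have "0 < real n * p" using n1 p by simp
  ultimately have "norm (x (real n * p)) \<le> C * (real n * p)"
    "norm (x (real (Suc n) * p)) \<le> C * (real (Suc n) * p)"
    by (auto intro!: growth)
  then have "norm (x (real (Suc n) * p) - x (real n * p)) \<le> C * (real (Suc n) * p) + C * (real n * p)"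
    using norm_triangle_ineq4[of "x (real (Suc n) * p)" "x (real n * p)"] by linarith
  also have "\<dots> = C * p * (2 * real n + 1)" by (simp add: algebra_simps)
  also have "\<dots> \<le> C * p * (3 * real n)" using n1 p by (intro mult_left_mono) (auto simp: C_def)
  also have "\<dots> = (3 * C * p) * real n" by simp
  also have "\<dots> \<le> real K * real n" using K by (intro mult_right_mono) auto
  also have "\<dots> \<le> real (Suc K) * real n" by (intro mult_right_mono) auto
  finally show False using big by simp
qed

section \<open>Increments of an additive process are uniformly tight\<close>

context additive_process
begin

text \<open>Otherwise there are times \<open>s\<^sub>n \<in> [0, T]\<close> with \<open>P(|X(T) - X(s\<^sub>n)| > n) > 1/2\<close>. Along a subsequence
  \<open>s\<^sub>n \<rightarrow> l\<close>; then \<open>X(s\<^sub>n) - X(l)\<close> tends to 0 in probability while \<open>X(T) - X(l)\<close> is a single finite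
  random variable, so these probabilities become smaller than \<open>1/4 + 1/4\<close>.\<close>
lemma increments_uniformly_tight:
  assumes T: "0 \<le> T"
  obtains a where "\<And>s. 0 \<le> s \<Longrightarrow> s \<le> T \<Longrightarrow> prob {\<omega>\<in>space M. a < norm (X T \<omega> - X s \<omega>)} \<le> 1 / 2"
proof (rule ccontr)
  assume "\<not> thesis"
  with that have "\<forall>n::nat. \<exists>s\<in>{0..T}. 1 / 2 < prob {\<omega>\<in>space M. real n < norm (X T \<omega> - X s \<omega>)}"
    by (metis atLeastAtMost_iff not_less)
  then obtain s where s: "\<And>n::nat. s n \<in> {0..T}"
    and big: "\<And>n. 1 / 2 < prob {\<omega>\<in>space M. real n < norm (X T \<omega> - X (s n) \<omega>)}"
    by metis
  obtain l r where l: "l \<in> {0..T}" and r: "strict_mono (r :: nat \<Rightarrow> nat)" and lim: "(s \<circ> r) \<longlonglongrightarrow> l"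
    using compact_Icc[of 0 T] s unfolding compact_def by metis
  have meas: "X t \<in> borel_measurable M" if "0 \<le> t" for t using measurable_process that .
  define f where "f t = prob {\<omega>\<in>space M. 1 < norm (X t \<omega> - X l \<omega>)}" for t
  \<comment> \<open>The limit in the definition of stochastic continuity leaves out the point \<open>l\<close> itself, which
    the subsequence may hit; \<open>f l = 0\<close> closes this gap.\<close>
  have "f l = 0" by (simp add: f_def)
  moreover have "(f \<longlongrightarrow> 0) (at l within {0..})"
    using stochastically_continuous l unfolding stochastically_continuous_def f_def by auto
  ultimately have "continuous (at l within {0..}) f" by (simp add: continuous_within)
  then have "(f \<circ> (s \<circ> r)) \<longlonglongrightarrow> f l"
    unfolding continuous_within_sequentially using lim s by (auto simp: comp_def)
  then have near: "eventually (\<lambda>n. f (s (r n)) < 1 / 4) sequentially"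
    using order_tendstoD(2)[of "f \<circ> (s \<circ> r)" "f l" sequentially "1/4"] \<open>f l = 0\<close> by simp
  have [measurable]: "X T \<in> borel_measurable M" "X l \<in> borel_measurable M"
    using T l by (auto intro: meas)
  have "(\<lambda>n. prob {\<omega>\<in>space M. real n < norm (X T \<omega> - X l \<omega>)}) \<longlonglongrightarrow> 0"
    by (rule prob_tail_tendsto_0) measurable
  then have "eventually (\<lambda>n. prob {\<omega>\<in>space M. real n < norm (X T \<omega> - X l \<omega>)} < 1 / 4) sequentially"
    by (rule order_tendstoD) simp
  then obtain k where k: "prob {\<omega>\<in>space M. real k < norm (X T \<omega> - X l \<omega>)} < 1 / 4"
    by (auto simp: eventually_sequentially)
  from near eventually_ge_at_top[of "Suc k"] have "eventually (\<lambda>n. f (s (r n)) < 1 / 4 \<and> Suc k \<le> n) sequentially"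
    by eventually_elim simp
  then obtain n where n: "f (s (r n)) < 1 / 4" "Suc k \<le> n" by (auto simp: eventually_sequentially)
  have rn: "Suc k \<le> r n" using n(2) seq_suble[OF r, of n] by linarith
  have [measurable]: "X (s (r n)) \<in> borel_measurable M" using s by (auto intro: meas)
  have "prob {\<omega>\<in>space M. real (r n) < norm (X T \<omega> - X (s (r n)) \<omega>)}
      \<le> prob ({\<omega>\<in>space M. real k < norm (X T \<omega> - X l \<omega>)} \<union>
              {\<omega>\<in>space M. 1 < norm (X (s (r n)) \<omega> - X l \<omega>)})"
  proof (intro finite_measure_mono subsetI)
    fix \<omega> assume \<omega>: "\<omega> \<in> {\<omega>\<in>space M. real (r n) < norm (X T \<omega> - X (s (r n)) \<omega>)}"
    have "norm (X T \<omega> - X (s (r n)) \<omega>) \<le> norm (X T \<omega> - X l \<omega>) + norm (X (s (r n)) \<omega> - X l \<omega>)"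
      using norm_triangle_ineq4[of "X T \<omega> - X l \<omega>" "X (s (r n)) \<omega> - X l \<omega>"] by simp
    with \<omega> rn show "\<omega> \<in> {\<omega>\<in>space M. real k < norm (X T \<omega> - X l \<omega>)} \<union>
              {\<omega>\<in>space M. 1 < norm (X (s (r n)) \<omega> - X l \<omega>)}" by auto
  qed measurable
  also have "\<dots> \<le> prob {\<omega>\<in>space M. real k < norm (X T \<omega> - X l \<omega>)} + f (s (r n))"
    unfolding f_def by (intro measure_Un_le) measurable
  finally show False using big[of "r n"] k n(1) by linarith
qed

end

section \<open>Increments over whole periods\<close>

definition block_increment :: "(real \<Rightarrow> 'w \<Rightarrow> 'a::euclidean_space) \<Rightarrow> real \<Rightarrow> nat \<Rightarrow> 'w \<Rightarrow> 'a" where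
  "block_increment X p n \<omega> = X (real (Suc n) * p) \<omega> - X (real n * p) \<omega>"

context semi_levy_process
begin

abbreviation (input) "\<xi> \<equiv> block_increment X p"

lemma measurable_at_multiple [measurable]: "X (real n * p) \<in> borel_measurable M"
  using period_pos by (intro measurable_process) simp

lemma block_increment_measurable [measurable]: "\<xi> n \<in> borel_measurable M"
  unfolding block_increment_def[abs_def] by measurable

lemma sum_block_increment: "(\<Sum>i<n. \<xi> i \<omega>) = X (real n * p) \<omega> - X 0 \<omega>"
  using sum_lessThan_telescope[of "\<lambda>i. X (real i * p) \<omega>" n] by (simp add: block_increment_def)

text \<open>The form with offsets \<open>s\<close> and \<open>t\<close> within the period serves two purposes: the offsets 0 and \<open>p\<close>
  show that the \<open>\<xi>\<^sub>n\<close> are identically distributed, and the offsets \<open>s\<close> and \<open>p\<close> carry the tightness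
  of the first period over to every period.\<close>
lemma distr_increment_shift_periods:
  assumes "0 \<le> s" "0 \<le> t"
  shows "distr M borel (\<lambda>\<omega>. X (real n * p + t) \<omega> - X (real n * p + s) \<omega>) =
         distr M borel (\<lambda>\<omega>. X t \<omega> - X s \<omega>)"
proof (induction n)
  case (Suc n)
  have *: "real (Suc n) * p + u = (real n * p + u) + p" for u by (simp add: algebra_simps)
  have "0 \<le> real n * p" using period_pos by simp
  then show ?case
    unfolding * Suc.IH[symmetric] using assms by (intro periodic_increments) auto
qed simp

lemma distr_block_increment: "distr M borel (\<xi> n) = distr M borel (\<xi> 0)"
  using distr_increment_shift_periods[of 0 p n] period_pos
  by (simp add: block_increment_def[abs_def] algebra_simps)

text \<open>Independence of increments speaks of finitely many times; independence of a sequence is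
  a statement about its finite subfamilies.\<close>
lemma indep_vars_block_increment: "indep_vars (\<lambda>_. borel) \<xi> UNIV"
proof -
  have fin: "indep_vars (\<lambda>_. borel) \<xi> {..<n}" for n
    using independent_increments[unfolded independent_increments_def, rule_format, of "\<lambda>i. real i * p" n]
      period_pos by (simp add: block_increment_def[abs_def])
  let ?F = "\<lambda>i. sigma_sets (space M) {\<xi> i -` A \<inter> space M |A. A \<in> sets borel}"
  have "indep_sets ?F UNIV"
  proof (subst indep_sets_finite_index_sets, intro allI impI)
    fix J :: "nat set" assume "finite J"
    then obtain n where "J \<subseteq> {..<n}" using finite_nat_iff_bounded by blast
    moreover have "indep_sets ?F {..<n}" using fin[of n] by (simp add: indep_vars_def)
    ultimately show "indep_sets ?F J" by (rule indep_sets_mono_index)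
  qed
  then show ?thesis by (simp add: indep_vars_def)
qed

lemma AE_block_increment_0: "AE \<omega> in M. \<xi> 0 \<omega> = X p \<omega>"
  using starts_at_zero by eventually_elim (simp add: block_increment_def)

lemma nn_integral_norm_block_increment_0:
  "(\<integral>\<^sup>+\<omega>. ennreal (norm (\<xi> 0 \<omega>)) \<partial>M) = (\<integral>\<^sup>+\<omega>. ennreal (norm (X p \<omega>)) \<partial>M)"
  by (rule nn_integral_cong_AE) (use AE_block_increment_0 in eventually_elim, simp)

section \<open>Oscillation within a period\<close>

text \<open>The supremum over the dyadic points of a period is a countable one, so this event is measurable;
  by right-continuity it controls the path at all times of the period.\<close>
definition dyadic_excursion :: "nat \<Rightarrow> real \<Rightarrow> 'w set" where
  "dyadic_excursion n b = {\<omega>\<in>space M. \<exists>m. \<exists>k\<le>2 ^ m.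
     b < norm (X (real n * p + real k * p / 2 ^ m) \<omega> - X (real n * p) \<omega>)}"

lemma grid_time_nonneg: "0 \<le> real n * p + real k * p / 2 ^ m"
  using period_pos by simp

lemma dyadic_excursion_eq:
  "dyadic_excursion n b = (\<Union>m. {\<omega>\<in>space M. \<exists>k\<in>{..2 ^ m}.
     b < norm (X (real n * p + real k * p / 2 ^ m) \<omega> - X (real n * p) \<omega>)})"
  by (auto simp: dyadic_excursion_def)

lemma grid_excursion_events:
  "{\<omega>\<in>space M. \<exists>k\<in>{..2 ^ m}. b < norm (X (real n * p + real k * p / 2 ^ m) \<omega> - X (real n * p) \<omega>)} \<in> events"
proof -
  have [measurable]: "X (real n * p + real k * p / 2 ^ m) \<in> borel_measurable M" for k
    by (intro measurable_process grid_time_nonneg)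
  show ?thesis by measurable
qed

lemma dyadic_excursion_events [measurable]: "dyadic_excursion n b \<in> events"
  unfolding dyadic_excursion_eq using grid_excursion_events by (intro sets.countable_UN) auto

text \<open>Ottaviani's inequality for the increments along the grid. The remainder after the
  \<open>k\<close>-th grid point has the law of \<open>X(p) - X(s)\<close> for the corresponding offset \<open>s\<close>.\<close>
lemma prob_grid_excursion_le:
  assumes tight: "\<And>s. 0 \<le> s \<Longrightarrow> s \<le> p \<Longrightarrow> prob {\<omega>\<in>space M. a < norm (X p \<omega> - X s \<omega>)} \<le> 1 / 2"
  shows "prob {\<omega>\<in>space M. \<exists>k\<in>{..2 ^ m}.
            2 * a < norm (X (real n * p + real k * p / 2 ^ m) \<omega> - X (real n * p) \<omega>)}
         \<le> 2 * prob {\<omega>\<in>space M. a < norm (\<xi> n \<omega>)}"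
proof -
  define \<tau> where "\<tau> k = real n * p + real k * p / 2 ^ m" for k :: nat
  define N :: nat where "N = 2 ^ m"
  have \<tau>0: "\<tau> 0 = real n * p" and \<tau>N: "\<tau> N = real n * p + p" by (auto simp: \<tau>_def N_def)
  have [measurable]: "X (\<tau> k) \<in> borel_measurable M" for k
    unfolding \<tau>_def by (intro measurable_process grid_time_nonneg)
  have sum: "(\<Sum>i\<in>{k..<l}. X (\<tau> (Suc i)) \<omega> - X (\<tau> i) \<omega>) = X (\<tau> l) \<omega> - X (\<tau> k) \<omega>" if "k \<le> l" for k l \<omega>
    using that by (rule sum_Suc_diff')
  have sum0: "(\<Sum>i<k. X (\<tau> (Suc i)) \<omega> - X (\<tau> i) \<omega>) = X (\<tau> k) \<omega> - X (real n * p) \<omega>" for k \<omega>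
    using sum[of 0 k \<omega>] by (simp add: lessThan_atLeast0 \<tau>0)
  have "prob {\<omega>\<in>space M. \<exists>k\<le>N. 2 * a < norm (\<Sum>i<k. X (\<tau> (Suc i)) \<omega> - X (\<tau> i) \<omega>)}
          \<le> 2 * prob {\<omega>\<in>space M. a < norm (\<Sum>i<N. X (\<tau> (Suc i)) \<omega> - X (\<tau> i) \<omega>)}"
  proof (rule ottaviani_inequality)
    show "indep_vars (\<lambda>_. borel) (\<lambda>i \<omega>. X (\<tau> (Suc i)) \<omega> - X (\<tau> i) \<omega>) {..<N}"
    proof (rule independent_increments[unfolded independent_increments_def, rule_format], intro conjI allI impI)
      show "0 \<le> \<tau> 0" using period_pos by (simp add: \<tau>0)
      show "\<tau> i < \<tau> (Suc i)" for i using period_pos by (simp add: \<tau>_def divide_strict_right_mono)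
    qed
    fix k assume k: "k \<le> N"
    define s where "s = real k * p / 2 ^ m"
    have "real k \<le> 2 ^ m" using k unfolding N_def by (metis of_nat_le_iff of_nat_numeral of_nat_power)
    then have s: "0 \<le> s" "s \<le> p" using period_pos by (auto simp: s_def field_simps)
    have [measurable]: "X p \<in> borel_measurable M" "X s \<in> borel_measurable M"
      using s period_pos by (auto intro: measurable_process)
    have "distr M borel (\<lambda>\<omega>. X (\<tau> N) \<omega> - X (\<tau> k) \<omega>) = distr M borel (\<lambda>\<omega>. X p \<omega> - X s \<omega>)"
      using distr_increment_shift_periods[of s p n] s period_pos unfolding \<tau>N
      by (simp add: \<tau>_def s_def)
    then have "prob {\<omega>\<in>space M. a < norm (X (\<tau> N) \<omega> - X (\<tau> k) \<omega>)} =
               prob {\<omega>\<in>space M. a < norm (X p \<omega> - X s \<omega>)}"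
      by (rule prob_norm_eq_if_distr_eq) measurable
    then show "prob {\<omega>\<in>space M. a < norm (\<Sum>i\<in>{k..<N}. X (\<tau> (Suc i)) \<omega> - X (\<tau> i) \<omega>)} \<le> 1 / 2"
      using tight[OF s] sum[OF k] by simp
  qed
  then show ?thesis
    unfolding sum0 by (simp add: \<tau>N \<tau>_def N_def block_increment_def Bex_def algebra_simps)
qed

text \<open>The bound on a grid does not depend on its mesh, and finer dyadic grids contain coarser ones, so
  it passes to the increasing union.\<close>
lemma prob_dyadic_excursion_le:
  assumes tight: "\<And>s. 0 \<le> s \<Longrightarrow> s \<le> p \<Longrightarrow> prob {\<omega>\<in>space M. a < norm (X p \<omega> - X s \<omega>)} \<le> 1 / 2"
  shows "prob (dyadic_excursion n (2 * a)) \<le> 2 * prob {\<omega>\<in>space M. a < norm (\<xi> n \<omega>)}"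
proof -
  let ?E = "\<lambda>m. {\<omega>\<in>space M. \<exists>k\<in>{..2 ^ m}.
            2 * a < norm (X (real n * p + real k * p / 2 ^ m) \<omega> - X (real n * p) \<omega>)}"
  have "incseq ?E"
  proof (intro incseq_SucI subsetI)
    fix m \<omega> assume "\<omega> \<in> ?E m"
    then obtain k where "\<omega> \<in> space M" and k: "k \<le> 2 ^ m"
      "2 * a < norm (X (real n * p + real k * p / 2 ^ m) \<omega> - X (real n * p) \<omega>)" by auto
    moreover have "real (2 * k) * p / 2 ^ Suc m = real k * p / 2 ^ m" by simp
    ultimately show "\<omega> \<in> ?E (Suc m)" by (auto intro!: bexI[of _ "2 * k"])
  qed
  then have "(\<lambda>m. prob (?E m)) \<longlonglongrightarrow> prob (\<Union>m. ?E m)"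
    using grid_excursion_events by (intro finite_Lim_measure_incseq) auto
  then show ?thesis
    unfolding dyadic_excursion_eq
    by (rule LIMSEQ_le_const2) (use prob_grid_excursion_le[OF tight] in blast)
qed

text \<open>Approximate \<open>s\<close> strictly from the right by dyadic points of the period and use right-continuity
  of the path.\<close>
lemma not_dyadic_excursion_bound:
  assumes \<omega>: "\<omega> \<in> space M" "\<omega> \<notin> dyadic_excursion n b" and s: "0 \<le> s" "s < p"
  shows "norm (X (real n * p + s) \<omega> - X (real n * p) \<omega>) \<le> b"
proof -
  \<comment> \<open>The added 1 makes the approximation strict; since \<open>s < p\<close>, the grid point still lies in the
    closed period.\<close>
  define k where "k m = nat \<lfloor>s * 2 ^ m / p\<rfloor> + 1" for m :: nat
  define d where "d m = real (k m) * p / 2 ^ m" for m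
  have floor: "real (k m) = of_int \<lfloor>s * 2 ^ m / p\<rfloor> + 1" for m
    using s period_pos by (simp add: k_def)
  have lower: "s < d m" for m
  proof -
    have "s * 2 ^ m / p < real (k m)" unfolding floor by linarith
    then show ?thesis using period_pos by (simp add: d_def field_simps)
  qed
  have upper: "d m \<le> s + p / 2 ^ m" for m
  proof -
    have "real (k m) \<le> s * 2 ^ m / p + 1" unfolding floor by linarith
    then have "real (k m) * p \<le> (s * 2 ^ m / p + 1) * p" using period_pos by (intro mult_right_mono) auto
    also have "\<dots> = s * 2 ^ m + p" using period_pos by (simp add: field_simps)
    finally show ?thesis by (simp add: d_def field_simps)
  qed
  have k_le: "k m \<le> 2 ^ m" for m
  proof -
    have "s * 2 ^ m / p < 2 ^ m" using s period_pos by (simp add: field_simps)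
    then have "\<lfloor>s * 2 ^ m / p\<rfloor> < 2 ^ m" by (simp add: floor_less_iff)
    moreover have "0 \<le> \<lfloor>s * 2 ^ m / p\<rfloor>" using s period_pos by simp
    ultimately have "int (k m) \<le> 2 ^ m" by (simp add: k_def)
    then show ?thesis by (metis of_nat_le_iff of_nat_numeral of_nat_power)
  qed
  have "d \<longlonglongrightarrow> s"
  proof (rule tendsto_sandwich[of "\<lambda>_. s" _ _ "\<lambda>m. s + p / 2 ^ m"])
    have "(\<lambda>m. s + p * (1 / 2) ^ m) \<longlonglongrightarrow> s + p * 0"
      by (intro tendsto_intros LIMSEQ_realpow_zero) auto
    then show "(\<lambda>m. s + p / 2 ^ m) \<longlonglongrightarrow> s" by (simp add: power_one_over field_simps)
  qed (use lower upper in \<open>auto intro!: always_eventually less_imp_le\<close>)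
  then have "(\<lambda>m. real n * p + d m) \<longlonglongrightarrow> real n * p + s" by (intro tendsto_intros)
  then have "filterlim (\<lambda>m. real n * p + d m) (at_right (real n * p + s)) sequentially"
    using lower less_imp_neq[OF lower, THEN not_sym] by (simp add: filterlim_at)
  moreover have "((\<lambda>t. X t \<omega>) \<longlongrightarrow> X (real n * p + s) \<omega>) (at_right (real n * p + s))"
    using cadlag_paths[OF \<omega>(1)] s period_pos by (simp add: cadlag_def continuous_within)
  ultimately have "(\<lambda>m. X (real n * p + d m) \<omega>) \<longlonglongrightarrow> X (real n * p + s) \<omega>"
    by (rule filterlim_compose[rotated])
  then have "(\<lambda>m. norm (X (real n * p + d m) \<omega> - X (real n * p) \<omega>)) \<longlonglongrightarrow>
      norm (X (real n * p + s) \<omega> - X (real n * p) \<omega>)" by (intro tendsto_intros)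
  moreover have "norm (X (real n * p + d m) \<omega> - X (real n * p) \<omega>) \<le> b" for m
    using \<omega> k_le[of m] unfolding dyadic_excursion_def d_def by (auto simp: not_less)
  ultimately show ?thesis by (intro LIMSEQ_le_const2) auto
qed

text \<open>Taking \<open>a = cn/2\<close>, which exceeds the tightness threshold for large \<open>n\<close>, the probability of an
  oscillation above \<open>cn\<close> is at most \<open>2 P(|\<xi>\<^sub>0| > cn/2)\<close>. These are summable by the finite mean, and
  the first Borel--Cantelli lemma applies.\<close>
lemma fluctuation_within_period_negligible:
  assumes fin: "(\<integral>\<^sup>+\<omega>. ennreal (norm (\<xi> 0 \<omega>)) \<partial>M) < \<infinity>" and c: "0 < c"
  shows "AE \<omega> in M. \<forall>\<^sub>F n in sequentially.
           \<forall>s\<in>{0..<p}. norm (X (real n * p + s) \<omega> - X (real n * p) \<omega>) \<le> c * real n"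
proof -
  obtain a where a: "\<And>s. 0 \<le> s \<Longrightarrow> s \<le> p \<Longrightarrow> prob {\<omega>\<in>space M. a < norm (X p \<omega> - X s \<omega>)} \<le> 1 / 2"
    using increments_uniformly_tight[of p] period_pos by auto
  let ?E = "\<lambda>n. dyadic_excursion n (2 * (c / 2 * real n))"
  obtain n0 :: nat where n0: "2 * a / c < real n0" using reals_Archimedean2 by blast
  have bound: "prob (?E n) \<le> 2 * prob {\<omega>\<in>space M. c / 2 * real n < norm (\<xi> 0 \<omega>)}" if "n0 \<le> n" for n
  proof -
    have "2 * a / c < real n" using n0 that by linarith
    then have le: "a \<le> c / 2 * real n" using c by (simp add: field_simps)
    have [measurable]: "X p \<in> borel_measurable M" using measurable_at_multiple[of 1] by simp
    have "prob (?E n) \<le> 2 * prob {\<omega>\<in>space M. c / 2 * real n < norm (\<xi> n \<omega>)}"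
    proof (rule prob_dyadic_excursion_le)
      fix s assume s: "0 \<le> s" "s \<le> p"
      have [measurable]: "X s \<in> borel_measurable M" using s by (intro measurable_process)
      have "prob {\<omega>\<in>space M. c / 2 * real n < norm (X p \<omega> - X s \<omega>)} \<le> prob {\<omega>\<in>space M. a < norm (X p \<omega> - X s \<omega>)}"
        using le by (intro finite_measure_mono) auto
      also have "\<dots> \<le> 1 / 2" using s by (rule a)
      finally show "prob {\<omega>\<in>space M. c / 2 * real n < norm (X p \<omega> - X s \<omega>)} \<le> 1 / 2" .
    qed
    also have "prob {\<omega>\<in>space M. c / 2 * real n < norm (\<xi> n \<omega>)} = prob {\<omega>\<in>space M. c / 2 * real n < norm (\<xi> 0 \<omega>)}"
      using distr_block_increment[of n] by (rule prob_norm_eq_if_distr_eq) measurable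
    finally show ?thesis .
  qed
  have "summable (\<lambda>n. prob {\<omega>\<in>space M. c / 2 * real n < norm (\<xi> 0 \<omega>)})"
    using fin c by (subst summable_prob_tail_iff) auto
  then have "summable (\<lambda>n. 2 * prob {\<omega>\<in>space M. c / 2 * real n < norm (\<xi> 0 \<omega>)})"
    by (rule summable_mult)
  then have "summable (\<lambda>n. prob (?E n))"
  proof (rule summable_comparison_test')
    show "norm (prob (?E n)) \<le> 2 * prob {\<omega>\<in>space M. c / 2 * real n < norm (\<xi> 0 \<omega>)}" if "n0 \<le> n" for n
      using bound[OF that] by simp
  qed
  then have "AE \<omega> in M. \<forall>\<^sub>F n in sequentially. \<omega> \<in> space M - ?E n"
    by (intro borel_cantelli_AE1) (auto simp: emeasure_eq_measure)
  then show ?thesis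
  proof eventually_elim
    case (elim \<omega>)
    then show ?case
    proof eventually_elim
      case (elim n)
      then show ?case using not_dyadic_excursion_bound[of \<omega> n "c * real n"] by simp
    qed
  qed
qed

end

section \<open>The strong law for semi-Levy processes\<close>

context semi_levy_process
begin

theorem strong_law_finite_mean:
  assumes fin: "(\<integral>\<^sup>+\<omega>. ennreal (norm (X p \<omega>)) \<partial>M) < \<infinity>"
  shows "AE \<omega> in M. ((\<lambda>t. (1 / t) *\<^sub>R X t \<omega>) \<longlongrightarrow> (1 / p) *\<^sub>R expectation (X p)) at_top"
proof -
  have [measurable]: "X p \<in> borel_measurable M" using measurable_at_multiple[of 1] by simp
  have fin0: "(\<integral>\<^sup>+\<omega>. ennreal (norm (\<xi> 0 \<omega>)) \<partial>M) < \<infinity>"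
    using fin by (simp add: nn_integral_norm_block_increment_0)
  then have int: "integrable M (\<xi> 0)" by (intro integrableI_bounded) auto
  have mean: "expectation (\<xi> 0) = expectation (X p)"
    using AE_block_increment_0 by (intro integral_cong_AE) auto
  have "AE \<omega> in M. (\<lambda>n. (1 / real n) *\<^sub>R (\<Sum>i<n. \<xi> i \<omega>)) \<longlonglongrightarrow> expectation (X p)"
    unfolding mean[symmetric]
    by (rule strong_law_of_large_numbers[OF indep_vars_block_increment distr_block_increment int])
  moreover have "AE \<omega> in M. \<forall>j. \<forall>\<^sub>F n in sequentially. \<forall>s\<in>{0..<p}.
      norm (X (real n * p + s) \<omega> - X (real n * p) \<omega>) \<le> 1 / real (Suc j) * real n"
    unfolding AE_all_countable
    by (intro allI fluctuation_within_period_negligible[OF fin0]) simp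
  ultimately show ?thesis
    using starts_at_zero
  proof eventually_elim
    case (elim \<omega>)
    show ?case
    proof (rule tendsto_scaled_process[OF period_pos])
      show "(\<lambda>n. (1 / real n) *\<^sub>R X (real n * p) \<omega>) \<longlonglongrightarrow> expectation (X p)"
        using elim(1,3) by (simp add: sum_block_increment)
      fix c :: real assume "0 < c"
      then obtain j where j: "1 / real (Suc j) < c" using nat_approx_posE by blast
      from elim(2)[rule_format, of j]
      show "\<forall>\<^sub>F n in sequentially. \<forall>s\<in>{0..<p}. norm (X (real n * p + s) \<omega> - X (real n * p) \<omega>) \<le> c * real n"
      proof eventually_elim
        case (elim n)
        have "1 / real (Suc j) * real n \<le> c * real n" using j by (intro mult_right_mono) auto
        with elim show ?case by (meson order_trans)
      qed
    qed
  qed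
qed

theorem strong_law_infinite_mean:
  assumes inf: "(\<integral>\<^sup>+\<omega>. ennreal (norm (X p \<omega>)) \<partial>M) = \<infinity>"
  shows "AE \<omega> in M. Limsup at_top (\<lambda>t. ereal ((1 / t) * norm (X t \<omega>))) = \<infinity>"
proof -
  have inf0: "(\<integral>\<^sup>+\<omega>. ennreal (norm (\<xi> 0 \<omega>)) \<partial>M) = \<infinity>"
    using inf by (simp add: nn_integral_norm_block_increment_0)
  have "AE \<omega> in M. \<exists>\<^sub>F n in sequentially. \<xi> n \<omega> \<in> {y. real (Suc K) * real n < norm y}" for K :: nat
  proof (rule indep_vars_frequently[OF indep_vars_block_increment])
    have "prob (\<xi> n -` {y. real (Suc K) * real n < norm y} \<inter> space M) =
          prob {\<omega>\<in>space M. real (Suc K) * real n < norm (\<xi> 0 \<omega>)}" for n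
    proof -
      have "\<xi> n -` {y. real (Suc K) * real n < norm y} \<inter> space M =
            {\<omega>\<in>space M. real (Suc K) * real n < norm (\<xi> n \<omega>)}" by auto
      then show ?thesis
        using prob_norm_eq_if_distr_eq[OF distr_block_increment[of n]] by simp
    qed
    moreover have "\<not> summable (\<lambda>n. prob {\<omega>\<in>space M. real (Suc K) * real n < norm (\<xi> 0 \<omega>)})"
      using inf0 by (subst summable_prob_tail_iff) auto
    ultimately show "\<not> summable (\<lambda>n. prob (\<xi> n -` {y. real (Suc K) * real n < norm y} \<inter> space M))"
      by simp
  qed measurable
  then have "AE \<omega> in M. \<forall>K::nat. \<exists>\<^sub>F n in sequentially. \<xi> n \<omega> \<in> {y. real (Suc K) * real n < norm y}"
    by (simp add: AE_all_countable)
  then show ?thesis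
    by eventually_elim
      (rule Limsup_norm_eq_infinity[OF period_pos], simp add: block_increment_def)
qed

end

theorem theorem5p2:
  fixes M :: "'w measure" and X :: "real \<Rightarrow> 'w \<Rightarrow> real ^ 'd" and p :: real
  assumes "semi_levy_process M X p"
  shows "((\<integral>\<^sup>+ \<omega>. ennreal (norm (X p \<omega>)) \<partial>M) < \<infinity> \<longrightarrow>
           (AE \<omega> in M. ((\<lambda>t. (1 / t) *\<^sub>R X t \<omega>) \<longlongrightarrow> (1 / p) *\<^sub>R (\<integral>\<omega>'. X p \<omega>' \<partial>M)) at_top))
       \<and> ((\<integral>\<^sup>+ \<omega>. ennreal (norm (X p \<omega>)) \<partial>M) = \<infinity> \<longrightarrow>
           (AE \<omega> in M. Limsup at_top (\<lambda>t. ereal ((1 / t) * norm (X t \<omega>))) = \<infinity>))"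
proof -
  interpret semi_levy_process M X p by (fact assms)
  show ?thesis using strong_law_finite_mean strong_law_infinite_mean by blast
qed

end
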